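(* Let $b,c\in\mathbb{R}$. The inequality $w_4-\frac12 w_3+b w_2+c w_1\ge 0$ holds for all $x,y,z\in\mathbb{R}$ if and only if $b\ge \max\left(-c,\ \frac{c}{2}-\frac{9}{8}\right)$.
   Context: For real $x,y,z$: $w_4=x^4+y^4+z^4$, $w_3=x^3y+y^3z+z^3x+xy^3+yz^3+zx^3$, $w_2=x^2y^2+y^2z^2+z^2x^2$, $w_1=xyz(x+y+z)$. *)

theory Defs
  imports Complex_Main
begin

definition w4 :: "real \<Rightarrow> real \<Rightarrow> real \<Rightarrow> real" where
  "w4 x y z = x^4 + y^4 + z^4"

definition w3 :: "real \<Rightarrow> real \<Rightarrow> real \<Rightarrow> real" where
  "w3 x y z = x^3 * y + y^3 * z + z^3 * x + x * y^3 + y * z^3 + z * x^3"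

definition w2 :: "real \<Rightarrow> real \<Rightarrow> real \<Rightarrow> real" where
  "w2 x y z = x^2 * y^2 + y^2 * z^2 + z^2 * x^2"

definition w1 :: "real \<Rightarrow> real \<Rightarrow> real \<Rightarrow> real" where
  "w1 x y z = x * y * z * (x + y + z)"

end

(* The region of admissible (b, c) is a cone with apex (-3/4, 3/4). The apex quartic is half the sum of
   ((x - y)(x + y - z/2))^2 over cyclic shifts, and moving into the cone adds nonnegative multiples of
   w2 - w1 = (1/2) sum z^2(x - y)^2 and w2 + 2 w1 = (xy + yz + zx)^2. Both bounds are sharp at zeros of
   the apex quartic: (1, 1, 1) and (2, 2, -1). *)
theory Submission
  imports Defs
begin

text \<open>The coefficients solve \<open>p + q = b + 3/4\<close> and
  \<open>2 * q - p = c - 3/4\<close>, the coordinates of \<open>(b, c)\<close> minus the apex along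
  \<open>w2 - w1\<close> and \<open>w2 + 2 * w1\<close>; the 6 is 3 times the 2 from
  \<open>w2 - w1\<close>.\<close>

lemma quartic_decomposition:
  fixes b c x y z :: real
  shows "w4 x y z - 1/2 * w3 x y z + b * w2 x y z + c * w1 x y z =
    (((x - y) * (x + y - z/2))\<^sup>2 + ((y - z) * (y + z - x/2))\<^sup>2 + ((z - x) * (z + x - y/2))\<^sup>2) / 2
    + (2 * b - c + 9/4) / 6 * ((z * (x - y))\<^sup>2 + (x * (y - z))\<^sup>2 + (y * (z - x))\<^sup>2)
    + (b + c) / 3 * (x * y + y * z + z * x)\<^sup>2"
  unfolding w4_def w3_def w2_def w1_def by (simp add: field_simps) algebra

theorem theorem2:
  fixes b c :: real
  shows "(\<forall>x y z :: real. w4 x y z - 1/2 * w3 x y z + b * w2 x y z + c * w1 x y z \<ge> 0)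
    \<longleftrightarrow> b \<ge> max (- c) (c / 2 - 9 / 8)"
proof
  assume nonneg: "\<forall>x y z :: real. w4 x y z - 1/2 * w3 x y z + b * w2 x y z + c * w1 x y z \<ge> 0"
  \<comment> \<open>At \<open>(1, 1, 1)\<close> only the last square survives, leaving
    \<open>3 * (b + c)\<close>.\<close>
  have "b \<ge> - c"
    using nonneg[rule_format, of 1 1 1] by (simp add: w4_def w3_def w2_def w1_def)
  \<comment> \<open>Here \<open>x * y + y * z + z * x = 0\<close>, so the value is
    \<open>12 * (2 * b - c + 9/4)\<close>.\<close>
  moreover have "b \<ge> c / 2 - 9 / 8"
    using nonneg[rule_format, of 2 2 "- 1"] by (simp add: w4_def w3_def w2_def w1_def)
  ultimately show "b \<ge> max (- c) (c / 2 - 9 / 8)" by simp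
next
  assume "b \<ge> max (- c) (c / 2 - 9 / 8)"
  then have "b + c \<ge> 0" "2 * b - c + 9/4 \<ge> 0" by auto
  then show "\<forall>x y z :: real. w4 x y z - 1/2 * w3 x y z + b * w2 x y z + c * w1 x y z \<ge> 0"
    unfolding quartic_decomposition by (intro allI add_nonneg_nonneg mult_nonneg_nonneg) auto
qed

end
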